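(* The meet-stalactic congruence $\equiv_{\mathrm{mSt}}$ is neither the left nor the right syntactic congruence of $\mathrm{Sh}_{\mathrm{mSt}}$, but it is still the (two-sided) syntactic congruence of $\mathrm{Sh}_{\mathrm{mSt}}$.
   Context: $\mathbb{N}=\{1,2,\dots\}$ and $\mathbb{N}^*$ is the free monoid of words over $\mathbb{N}$. For a set $S$ and a function $f:\mathbb{N}^*\to S$, a congruence $\equiv$ on $\mathbb{N}^*$ is the (two-sided) syntactic congruence of $f$ if $u\equiv v\Leftrightarrow(\forall r,s\in\mathbb{N}^*,\ f(rus)=f(rvs))$; a left congruence $\equiv$ is the left syntactic congruence of $f$ if $u\equiv v\Leftrightarrow(\forall r\in\mathbb{N}^*,\ f(ru)=f(rv))$; a right congruence $\equiv$ is the right syntactic congruence of $f$ if $u\equiv v\Leftrightarrow(\forall s\in\mathbb{N}^*,\ f(us)=f(vs))$. A stalactic tableau is a top-aligned finite sequence of nonempty columns of cells, labelled by $\mathbb{N}$, such that all cells in a column have the same label and distinct columns have distinct labels; its shape is the underlying unlabelled diagram, i.e. the sequence of column lengths from left to right. For a word $w$, $\mathrm{P}^{\to}_{\mathrm{lSt}}(w)$ is obtained from the empty tableau by reading $w$ left to right and inserting letters: to insert $a$, if $a$ labels no cell, add a new one-cell column labelled $a$ at the right; otherwise add a cell labelled $a$ to the bottom of the column labelled $a$. $\mathrm{P}^{\leftarrow}_{\mathrm{rSt}}(w)$ is obtained in the same way reading $w$ right to left and adding new columns at the left. $\mathrm{P}_{\mathrm{mSt}}(w)=(\mathrm{P}^{\to}_{\mathrm{lSt}}(w),\mathrm{P}^{\leftarrow}_{\mathrm{rSt}}(w))$,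 the meet-stalactic congruence is given by $u\equiv_{\mathrm{mSt}}v$ iff $\mathrm{P}_{\mathrm{mSt}}(u)=\mathrm{P}_{\mathrm{mSt}}(v)$, and $\mathrm{Sh}_{\mathrm{mSt}}(w)$ is the pair formed by the shapes of $\mathrm{P}^{\to}_{\mathrm{lSt}}(w)$ and $\mathrm{P}^{\leftarrow}_{\mathrm{rSt}}(w)$. *)

theory Defs
  imports Main
begin

definition words :: "nat list set" where
  "words = lists {1..}"


subsection \<open>Congruences on the free monoid\<close>

definition left_congruence :: "nat list rel \<Rightarrow> bool" where
  "left_congruence R \<longleftrightarrow> equiv words R \<and>
     (\<forall>(u, v) \<in> R. \<forall>r \<in> words. (r @ u, r @ v) \<in> R)"

definition right_congruence :: "nat list rel \<Rightarrow> bool" where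
  "right_congruence R \<longleftrightarrow> equiv words R \<and>
     (\<forall>(u, v) \<in> R. \<forall>s \<in> words. (u @ s, v @ s) \<in> R)"

definition congruence :: "nat list rel \<Rightarrow> bool" where
  "congruence R \<longleftrightarrow> left_congruence R \<and> right_congruence R"

definition is_syntactic_congruence :: "nat list rel \<Rightarrow> (nat list \<Rightarrow> 's) \<Rightarrow> bool" where
  "is_syntactic_congruence R f \<longleftrightarrow> congruence R \<and>
     (\<forall>u \<in> words. \<forall>v \<in> words.
        (u, v) \<in> R \<longleftrightarrow> (\<forall>r \<in> words. \<forall>s \<in> words. f (r @ u @ s) = f (r @ v @ s)))"

definition is_left_syntactic_congruence :: "nat list rel \<Rightarrow> (nat list \<Rightarrow> 's) \<Rightarrow> bool" where
  "is_left_syntactic_congruence R f \<longleftrightarrow> left_congruence R \<and>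
     (\<forall>u \<in> words. \<forall>v \<in> words.
        (u, v) \<in> R \<longleftrightarrow> (\<forall>r \<in> words. f (r @ u) = f (r @ v)))"

definition is_right_syntactic_congruence :: "nat list rel \<Rightarrow> (nat list \<Rightarrow> 's) \<Rightarrow> bool" where
  "is_right_syntactic_congruence R f \<longleftrightarrow> right_congruence R \<and>
     (\<forall>u \<in> words. \<forall>v \<in> words.
        (u, v) \<in> R \<longleftrightarrow> (\<forall>s \<in> words. f (u @ s) = f (v @ s)))"


subsection \<open>Stalactic tableaux\<close>

text \<open>
  A tableau is the list of its columns from left to right; a column is the list of the
  labels of its cells from top to bottom.
\<close>

type_synonym tableau = "nat list list"

definition stalactic_tableau :: "tableau \<Rightarrow> bool" where
  "stalactic_tableau T \<longleftrightarrow>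
     (\<forall>c \<in> set T. \<exists>a \<ge> 1. set c = {a}) \<and>
     (\<forall>i < length T. \<forall>j < length T. i \<noteq> j \<longrightarrow> set (T ! i) \<inter> set (T ! j) = {})"

definition shape :: "tableau \<Rightarrow> nat list" where
  "shape T = map length T"

definition add_cell :: "nat \<Rightarrow> tableau \<Rightarrow> tableau" where
  "add_cell a T = map (\<lambda>c. if a \<in> set c then c @ [a] else c) T"

definition insert_right :: "nat \<Rightarrow> tableau \<Rightarrow> tableau" where
  "insert_right a T =
     (if \<exists>c \<in> set T. a \<in> set c then add_cell a T else T @ [[a]])"

definition insert_left :: "nat \<Rightarrow> tableau \<Rightarrow> tableau" where
  "insert_left a T =
     (if \<exists>c \<in> set T. a \<in> set c then add_cell a T else [a] # T)"

text \<open>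
  \<^term>\<open>fold\<close> inserts the first letter of the word first, \<^term>\<open>foldr\<close> inserts its last letter
  first.
\<close>

definition P_lSt :: "nat list \<Rightarrow> tableau" where
  "P_lSt w = fold insert_right w []"

definition P_rSt :: "nat list \<Rightarrow> tableau" where
  "P_rSt w = foldr insert_left w []"

lemma stalactic_tableau_Cons:
  "stalactic_tableau (c # T) \<longleftrightarrow>
     (\<exists>a \<ge> 1. set c = {a}) \<and> (\<forall>d \<in> set T. set c \<inter> set d = {}) \<and> stalactic_tableau T"
  unfolding stalactic_tableau_def
  by (auto simp: All_less_Suc2 all_set_conv_all_nth) blast+

lemma stalactic_tableau_snoc:
  "stalactic_tableau (T @ [c]) \<longleftrightarrow>
     (\<exists>a \<ge> 1. set c = {a}) \<and> (\<forall>d \<in> set T. set c \<inter> set d = {}) \<and> stalactic_tableau T"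
proof (induction T)
  case Nil
  show ?case by (simp add: stalactic_tableau_def)
next
  case (Cons d T)
  show ?case by (simp add: stalactic_tableau_Cons Cons.IH) blast
qed

lemma stalactic_tableau_add_cell:
  assumes "stalactic_tableau T"
  shows "stalactic_tableau (add_cell a T)"
proof -
  have "set (add_cell a T ! i) = set (T ! i)" if "i < length T" for i
    using that by (auto simp: add_cell_def)
  moreover have "length (add_cell a T) = length T"
    by (simp add: add_cell_def)
  moreover have "\<exists>b \<ge> 1. set c = {b}" if "c \<in> set (add_cell a T)" for c
    using that assms by (force simp: add_cell_def stalactic_tableau_def split: if_splits)
  ultimately show ?thesis
    using assms by (simp add: stalactic_tableau_def)
qed

lemma stalactic_tableau_P_lSt:
  assumes "w \<in> words"
  shows "stalactic_tableau (P_lSt w)"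
  using assms
proof (induction w rule: rev_induct)
  case Nil
  show ?case by (simp add: P_lSt_def stalactic_tableau_def)
next
  case (snoc a w)
  then have "a \<ge> 1" "stalactic_tableau (P_lSt w)"
    by (auto simp: words_def)
  then have "stalactic_tableau (insert_right a (P_lSt w))"
    by (auto simp: insert_right_def stalactic_tableau_snoc stalactic_tableau_add_cell)
  then show ?case by (simp add: P_lSt_def)
qed

lemma stalactic_tableau_P_rSt:
  assumes "w \<in> words"
  shows "stalactic_tableau (P_rSt w)"
  using assms
proof (induction w)
  case Nil
  show ?case by (simp add: P_rSt_def stalactic_tableau_def)
next
  case (Cons a w)
  then have "a \<ge> 1" "stalactic_tableau (P_rSt w)"
    by (auto simp: words_def)
  then have "stalactic_tableau (insert_left a (P_rSt w))"
    by (auto simp: insert_left_def stalactic_tableau_Cons stalactic_tableau_add_cell)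
  then show ?case by (simp add: P_rSt_def)
qed


subsection \<open>The meet-stalactic congruence\<close>

definition P_mSt :: "nat list \<Rightarrow> tableau \<times> tableau" where
  "P_mSt w = (P_lSt w, P_rSt w)"

definition mSt :: "nat list rel" where
  "mSt = {(u, v). u \<in> words \<and> v \<in> words \<and> P_mSt u = P_mSt v}"

definition Sh_mSt :: "nat list \<Rightarrow> nat list \<times> nat list" where
  "Sh_mSt w = (shape (P_lSt w), shape (P_rSt w))"

end

theory Submission
  imports Defs
begin

text \<open>
  The two tableaux of \<open>w\<close> amount to the multiplicities of the letters of \<open>w\<close> together with the
  orders of their first and of their last occurrences. If \<open>x\<close> and \<open>y\<close> are the \<open>i\<close>-th letters in
  the first-occurrence orders of \<open>u\<close> and \<open>v\<close>, appending many copies of \<open>x\<close> keeps both orders and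
  makes the \<open>i\<close>-th columns of different lengths unless \<open>x = y\<close>; dually on the left for last
  occurrences. A context on one side only cannot do both: \<open>1212\<close> and \<open>2112\<close> differ in the order of
  first occurrences of two equally frequent letters, which no prefix can reveal, and \<open>2121\<close>
  and \<open>2112\<close> behave in the mirrored way.
\<close>

lemma insert_left_rev: "insert_left a (rev T) = rev (insert_right a T)"
  by (simp add: insert_left_def insert_right_def add_cell_def rev_map)

text \<open>Reversing words and tableaux exchanges the two insertion procedures, so it suffices to
  analyse \<open>P_rSt\<close>.\<close>

lemma P_lSt_conv_P_rSt: "P_lSt w = rev (P_rSt (rev w))"
proof (induction w rule: rev_induct)
  case Nil
  show ?case by (simp add: P_lSt_def P_rSt_def)
next
  case (snoc a w)
  then show ?case
    by (simp add: P_lSt_def P_rSt_def) (metis insert_left_rev rev_rev_ident)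
qed

text \<open>\<open>remdups\<close> keeps the last occurrence of each letter. Reading from right to
  left meets a letter first at its last occurrence and puts its new column to the left of all
  earlier ones.\<close>

lemma P_rSt_conv_remdups: "P_rSt w = map (\<lambda>a. replicate (count_list w a) a) (remdups w)"
proof (induction w)
  case Nil
  show ?case by (simp add: P_rSt_def)
next
  case (Cons a w)
  have ex: "(\<exists>c \<in> set (P_rSt w). a \<in> set c) \<longleftrightarrow> a \<in> set w"
    by (auto simp: Cons.IH count_list_0_iff)
  have "P_rSt (a # w) = insert_left a (P_rSt w)"
    by (simp add: P_rSt_def)
  also have "\<dots> = map (\<lambda>b. replicate (count_list (a # w) b) b) (remdups (a # w))"
  proof (cases "a \<in> set w")
    case True
    then have "insert_left a (P_rSt w) = add_cell a (P_rSt w)"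
      using ex by (simp add: insert_left_def)
    with True show ?thesis
      by (auto simp: Cons.IH add_cell_def replicate_append_same count_list_0_iff)
  next
    case False
    then have "insert_left a (P_rSt w) = [a] # P_rSt w"
      using ex by (simp add: insert_left_def)
    with False show ?thesis
      by (auto simp: Cons.IH)
  qed
  finally show ?case .
qed

lemma shape_P_rSt: "shape (P_rSt w) = map (count_list w) (remdups w)"
  by (simp add: shape_def P_rSt_conv_remdups)

lemma shape_P_lSt: "shape (P_lSt w) = rev (map (count_list w) (remdups (rev w)))"
  by (simp add: P_lSt_conv_P_rSt shape_def P_rSt_conv_remdups rev_map)

lemma Sh_mSt_eq_iff:
  "Sh_mSt u = Sh_mSt v \<longleftrightarrow>
     map (count_list u) (remdups u) = map (count_list v) (remdups v) \<and>
     map (count_list u) (remdups (rev u)) = map (count_list v) (remdups (rev v))"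
  by (auto simp: Sh_mSt_def shape_P_rSt shape_P_lSt)

text \<open>The top cells of the columns spell out \<open>remdups\<close>, and the column lengths
  are the counts; a letter without a column has count 0 in both words.\<close>

lemma P_rSt_eq_iff:
  "P_rSt u = P_rSt v \<longleftrightarrow> remdups u = remdups v \<and> count_list u = count_list v"
proof
  assume eq: "P_rSt u = P_rSt v"
  have "map hd (P_rSt w) = remdups w" for w
    by (auto simp: P_rSt_conv_remdups count_list_0_iff intro!: map_idI)
  with eq have rem: "remdups u = remdups v"
    by metis
  then have set_eq: "set u = set v"
    by (metis set_remdups)
  have "map (count_list u) (remdups u) = map (count_list v) (remdups u)"
    using eq rem by (metis shape_P_rSt)
  then have "count_list u a = count_list v a" for a
    by (cases "a \<in> set u") (use set_eq in \<open>auto simp: count_list_0_iff\<close>)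
  with rem show "remdups u = remdups v \<and> count_list u = count_list v"
    by auto
qed (simp add: P_rSt_conv_remdups)

lemma P_mSt_eq_iff:
  "P_mSt u = P_mSt v \<longleftrightarrow>
     count_list u = count_list v \<and> remdups u = remdups v \<and> remdups (rev u) = remdups (rev v)"
  by (auto simp: P_mSt_def P_lSt_conv_P_rSt P_rSt_eq_iff fun_eq_iff)

lemma Sh_mSt_eq_if_P_mSt_eq: "P_mSt u = P_mSt v \<Longrightarrow> Sh_mSt u = Sh_mSt v"
  by (simp add: P_mSt_def Sh_mSt_def)

lemma append_in_words: "u \<in> words \<Longrightarrow> v \<in> words \<Longrightarrow> u @ v \<in> words"
  by (auto simp: words_def)

text \<open>With its counterpart \<open>remdups_append2\<close>, this makes \<open>remdups\<close>
  of a product depend only on \<open>remdups\<close> of the two factors.\<close>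

lemma remdups_remdups_append: "remdups (remdups xs @ ys) = remdups (xs @ ys)"
  by (induction xs) auto

text \<open>Varying both factors at once serves left, right and two-sided contexts alike.\<close>

lemma P_mSt_append_cong:
  assumes "P_mSt u = P_mSt u'" "P_mSt v = P_mSt v'"
  shows "P_mSt (u @ v) = P_mSt (u' @ v')"
proof -
  have remdups_cong: "remdups (x @ y) = remdups (x' @ y')"
    if "remdups x = remdups x'" "remdups y = remdups y'" for x y x' y' :: "nat list"
    using that by (metis remdups_remdups_append remdups_append2)
  have "count_list (u @ v) = count_list (u' @ v')"
    using assms by (simp add: P_mSt_eq_iff fun_eq_iff)
  moreover have "remdups (u @ v) = remdups (u' @ v')"
    using assms by (intro remdups_cong) (simp_all add: P_mSt_eq_iff)
  moreover have "remdups (rev v @ rev u) = remdups (rev v' @ rev u')"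
    using assms by (intro remdups_cong) (simp_all add: P_mSt_eq_iff)
  ultimately show ?thesis
    by (simp add: P_mSt_eq_iff)
qed

lemma congruence_mSt: "congruence mSt"
proof -
  have "equiv words mSt"
    by (auto simp: mSt_def equiv_def refl_on_def sym_def trans_def)
  then show ?thesis
    by (auto simp: congruence_def left_congruence_def right_congruence_def mSt_def
        intro: append_in_words P_mSt_append_cong)
qed

text \<open>Prepended copies of a letter of \<open>u\<close> change its count but not the order of
  last occurrences. Only one component of the shape enters, so that the lemma also applies to
  reversed words.\<close>

lemma remdups_eq_if_prepend:
  assumes count: "count_list u = count_list v"
    and shape: "\<And>x n. x \<in> set u \<Longrightarrow>
      map (count_list (replicate n x @ u)) (remdups (replicate n x @ u)) =
      map (count_list (replicate n x @ v)) (remdups (replicate n x @ v))"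
  shows "remdups u = remdups v"
proof -
  have set_eq: "set u = set v"
    using count by (metis count_list_0_iff subsetI subset_antisym)
  show ?thesis
  proof (rule nth_equalityI)
    show "length (remdups u) = length (remdups v)"
      by (simp add: length_remdups_card_conv set_eq)
  next
    fix i assume i: "i < length (remdups u)"
    define x y where "x = remdups u ! i" and "y = remdups v ! i"
    have x: "x \<in> set u"
      using i unfolding x_def by (metis nth_mem set_remdups)
    have i': "i < length (remdups v)"
      using i by (simp add: length_remdups_card_conv set_eq)
    \<comment> \<open>With one copy more than \<open>y\<close> has occurrences, the column of
      \<open>x\<close> after \<open>r @ u\<close> is longer than that of \<open>y\<close> after
      \<open>r @ v\<close> if \<open>x\<close> and \<open>y\<close> differ.\<close>
    define r where "r = replicate (Suc (count_list u y)) x"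
    have "set r \<subseteq> set u"
      using x unfolding r_def by (metis empty_subsetI insert_subset set_replicate_Suc)
    then have "remdups (r @ u) = remdups u" "remdups (r @ v) = remdups v"
      using set_eq by (simp_all add: remdups_append)
    then have "map (count_list (r @ u)) (remdups u) = map (count_list (r @ v)) (remdups v)"
      using shape[OF x, of "Suc (count_list u y)"] by (simp only: r_def)
    then have "map (count_list (r @ u)) (remdups u) ! i = map (count_list (r @ v)) (remdups v) ! i"
      by (rule arg_cong)
    then have "count_list (r @ u) x = count_list (r @ v) y"
      using i i' by (simp only: nth_map x_def y_def)
    moreover have "count_list r y = 0" if "x \<noteq> y"
      using that by (auto simp: r_def count_list_0_iff)
    moreover have "count_list r x = Suc (count_list u y)"
      unfolding r_def by (subst count_list_eq_length_filter) simp
    ultimately have "x = y"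
      using count by (cases "x = y") auto
    then show "remdups u ! i = remdups v ! i"
      by (simp only: x_def y_def)
  qed
qed

lemma P_mSt_eq_if_Sh_mSt_eq:
  assumes u: "u \<in> words" and v: "v \<in> words"
    and Sh: "\<And>r s. r \<in> words \<Longrightarrow> s \<in> words \<Longrightarrow> Sh_mSt (r @ u @ s) = Sh_mSt (r @ v @ s)"
  shows "P_mSt u = P_mSt v"
proof -
  have Nil: "[] \<in> words"
    by (simp add: words_def)
  have rep: "replicate n x \<in> words" if "x \<in> set u" for n x
    using that u by (auto simp: words_def)
  have "count_list u a = count_list v a" for a
  proof (cases "a \<in> set u \<union> set v")
    case True
    then have "[a] \<in> words"
      using u v by (auto simp: words_def)
    \<comment> \<open>Reading \<open>a\<close> last, after \<open>u\<close> or \<open>v\<close>, makes its column the rightmost one.\<close>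
    then have "last (map (count_list (u @ [a])) (remdups (u @ [a]))) =
        last (map (count_list (v @ [a])) (remdups (v @ [a])))"
      using Sh[OF Nil, of "[a]"] by (simp add: Sh_mSt_eq_iff)
    moreover have "last (map f (remdups (w @ [a]))) = f a" for f :: "nat \<Rightarrow> nat" and w
      by (induction w) auto
    ultimately show ?thesis
      by simp
  next
    case False
    then show ?thesis by simp
  qed
  then have count: "count_list u = count_list v"
    by auto
  have "remdups u = remdups v"
    using count
  proof (rule remdups_eq_if_prepend)
    fix x n assume "x \<in> set u"
    from Sh[OF rep[OF this] Nil, of n]
    show "map (count_list (replicate n x @ u)) (remdups (replicate n x @ u)) =
        map (count_list (replicate n x @ v)) (remdups (replicate n x @ v))"
      by (simp add: Sh_mSt_eq_iff)
  qed
  \<comment> \<open>Reversal keeps counts and turns appended copies of \<open>x\<close> into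
    prepended ones.\<close>
  moreover have "remdups (rev u) = remdups (rev v)"
  proof (rule remdups_eq_if_prepend)
    show "count_list (rev u) = count_list (rev v)"
      using count by auto
  next
    fix x n assume "x \<in> set (rev u)"
    then have "x \<in> set u" by simp
    from Sh[OF Nil rep[OF this], of n]
    have "map (count_list (u @ replicate n x)) (remdups (rev (u @ replicate n x))) =
        map (count_list (v @ replicate n x)) (remdups (rev (v @ replicate n x)))"
      by (simp add: Sh_mSt_eq_iff)
    moreover have "count_list (w @ replicate n x) = count_list (replicate n x @ rev w)" for w
      by auto
    ultimately show "map (count_list (replicate n x @ rev u)) (remdups (replicate n x @ rev u)) =
        map (count_list (replicate n x @ rev v)) (remdups (replicate n x @ rev v))"
      by (metis rev_append rev_replicate)
  qed
  ultimately show ?thesis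
    using count by (simp add: P_mSt_eq_iff)
qed

lemma not_left_syntactic: "\<not> is_left_syntactic_congruence mSt Sh_mSt"
proof
  assume "is_left_syntactic_congruence mSt Sh_mSt"
  moreover have "[1,2,1,2] \<in> words" "[2,1,1,2] \<in> words"
    by (auto simp: words_def)
  moreover have "Sh_mSt (r @ [1,2,1,2]) = Sh_mSt (r @ [2,1,1,2])" for r
  proof -
    have "count_list (r @ [1,2,1,2]) = count_list (r @ [2,1,1,2])"
      by auto
    moreover have "remdups (r @ [1,2,1,2]) = remdups (r @ [2,1,1,2])"
      using remdups_append2[of r "[1,2,1,2]"] remdups_append2[of r "[2,1,1,2]"] by simp
    \<comment> \<open>If \<open>r\<close> contains 1 or 2, the two orders of first occurrences
      agree. Otherwise they differ by swapping 1 and 2, which both have count 2.\<close>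
    moreover have "map (count_list (r @ [1,2,1,2])) (remdups (rev (r @ [1,2,1,2]))) =
        map (count_list (r @ [1,2,1,2])) (remdups (rev (r @ [2,1,1,2])))"
      by (auto simp: count_list_0_iff)
    ultimately show ?thesis
      by (metis Sh_mSt_eq_iff)
  qed
  ultimately have "([1,2,1,2], [2,1,1,2]) \<in> mSt"
    unfolding is_left_syntactic_congruence_def by blast
  then show False
    by (simp add: mSt_def P_mSt_eq_iff)
qed

text \<open>This mirrors the left case: \<open>[2,1,2,1]\<close> is the reversal of
  \<open>[1,2,1,2]\<close>, and \<open>[2,1,1,2]\<close> is a palindrome.\<close>

lemma not_right_syntactic: "\<not> is_right_syntactic_congruence mSt Sh_mSt"
proof
  assume "is_right_syntactic_congruence mSt Sh_mSt"
  moreover have "[2,1,2,1] \<in> words" "[2,1,1,2] \<in> words"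
    by (auto simp: words_def)
  moreover have "Sh_mSt ([2,1,2,1] @ s) = Sh_mSt ([2,1,1,2] @ s)" for s
  proof -
    have "count_list ([2,1,2,1] @ s) = count_list ([2,1,1,2] @ s)"
      by auto
    moreover have "remdups (rev ([2,1,2,1] @ s)) = remdups (rev ([2,1,1,2] @ s))"
      using remdups_append2[of "rev s" "[1,2,1,2]"] remdups_append2[of "rev s" "[2,1,1,2]"] by simp
    moreover have "map (count_list ([2,1,2,1] @ s)) (remdups ([2,1,2,1] @ s)) =
        map (count_list ([2,1,2,1] @ s)) (remdups ([2,1,1,2] @ s))"
      by (auto simp: count_list_0_iff)
    ultimately show ?thesis
      by (metis Sh_mSt_eq_iff)
  qed
  ultimately have "([2,1,2,1], [2,1,1,2]) \<in> mSt"
    unfolding is_right_syntactic_congruence_def by blast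
  then show False
    by (simp add: mSt_def P_mSt_eq_iff)
qed

theorem proposition6p5:
  shows "\<not> is_left_syntactic_congruence mSt Sh_mSt
    \<and> \<not> is_right_syntactic_congruence mSt Sh_mSt
    \<and> is_syntactic_congruence mSt Sh_mSt"
proof (intro conjI)
  show "is_syntactic_congruence mSt Sh_mSt"
    unfolding is_syntactic_congruence_def
  proof (intro conjI ballI congruence_mSt)
    fix u v assume uv: "u \<in> words" "v \<in> words"
    show "(u, v) \<in> mSt \<longleftrightarrow>
      (\<forall>r \<in> words. \<forall>s \<in> words. Sh_mSt (r @ u @ s) = Sh_mSt (r @ v @ s))"
      using uv P_mSt_eq_if_Sh_mSt_eq[OF uv]
      by (auto simp: mSt_def intro!: Sh_mSt_eq_if_P_mSt_eq P_mSt_append_cong)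
  qed
qed (rule not_left_syntactic not_right_syntactic)+

end
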